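(* Let $\kappa$ be a singular cardinal such that the set $\{\mu<\kappa: 2^\mu=\mu^+\}$ contains a club in $\kappa$. Let $X$ be a graph of size $\kappa$ and $\lambda$ an infinite cardinal (with $\lambda<\kappa$). If $\mathrm{List}(Y)\le\lambda$ for every subgraph $Y$ of $X$ of size $<\kappa$, then $\mathrm{List}(X)\le\lambda$.
   Context: A graph is a pair $X=\langle V_X,\mathcal{E}_X\rangle$ with $\mathcal{E}_X\subseteq[V_X]^2$; its size is $|V_X|$. A subgraph $Y$ of $X$ satisfies $V_Y\subseteq V_X$, $\mathcal{E}_Y\subseteq\mathcal{E}_X$. A good coloring of $X$ is $f:X\to\mathrm{ON}$ with $f(x)\ne f(y)$ whenever $\{x,y\}\in\mathcal{E}_X$. A $\lambda$-assignment is $F:X\to[\mathrm{ON}]^\lambda$. $\mathrm{List}(X)$ is the least cardinal $\lambda$ such that for every $\lambda$-assignment $F$ there is a good coloring $f$ with $f(x)\in F(x)$ for all $x$. *)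

theory Defs
  imports Main
begin

unbundle cardinal_syntax

text \<open>
  As in the BNF cardinal library, a cardinal is a relation \<open>r\<close> with \<open>Card_order r\<close>,
  taken up to \<open>=o\<close>. An ordinal below \<open>r\<close> is an element \<open>a\<close> of \<open>Field r\<close>;
  its order type is that of \<open>Restr r (underS r a)\<close>.
\<close>

definition singular_cardinal :: "'k rel \<Rightarrow> bool" where
  "singular_cardinal \<kappa> \<longleftrightarrow> Cinfinite \<kappa> \<and> \<not> regularCard \<kappa>"

text \<open>
  In \<open>closed_in\<close>, \<open>\<delta>\<close> ranges over the limit points of \<open>C\<close> below \<open>\<kappa>\<close>: the second
  premise says that \<open>C\<close> is strictly unbounded in \<open>\<delta>\<close>, so together with \<open>\<delta> \<noteq> 0\<close> it makes
  \<open>\<delta>\<close> a limit ordinal. There is no restriction on the cofinality of \<open>\<kappa>\<close>.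
\<close>

definition closed_in :: "'k set \<Rightarrow> 'k rel \<Rightarrow> bool" where
  "closed_in C \<kappa> \<longleftrightarrow>
     (\<forall>\<delta>\<in>Field \<kappa>. underS \<kappa> \<delta> \<noteq> {} \<and>
        (\<forall>\<alpha>\<in>underS \<kappa> \<delta>. \<exists>\<beta>\<in>C \<inter> underS \<kappa> \<delta>. \<alpha> \<noteq> \<beta> \<and> (\<alpha>, \<beta>) \<in> \<kappa>) \<longrightarrow> \<delta> \<in> C)"

definition club_in :: "'k set \<Rightarrow> 'k rel \<Rightarrow> bool" where
  "club_in C \<kappa> \<longleftrightarrow> C \<subseteq> Field \<kappa> \<and> cofinal C \<kappa> \<and> closed_in C \<kappa>"

definition ordinal_below :: "'k rel \<Rightarrow> 'k \<Rightarrow> 'k rel" where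
  "ordinal_below \<kappa> a = Restr \<kappa> (underS \<kappa> a)"

definition GCH_cardinals_below :: "'k rel \<Rightarrow> 'k set" where
  "GCH_cardinals_below \<kappa> =
     {\<mu> \<in> Field \<kappa>. Card_order (ordinal_below \<kappa> \<mu>) \<and>
        ctwo ^c ordinal_below \<kappa> \<mu> =o cardSuc (ordinal_below \<kappa> \<mu>)}"

datatype 'v graph = Graph (verts: "'v set") (edges: "'v set set")

definition is_graph :: "'v graph \<Rightarrow> bool" where
  "is_graph X \<longleftrightarrow> edges X \<subseteq> {e. e \<subseteq> verts X \<and> card e = 2}"

definition subgraph :: "'v graph \<Rightarrow> 'v graph \<Rightarrow> bool" where
  "subgraph Y X \<longleftrightarrow> is_graph Y \<and> verts Y \<subseteq> verts X \<and> edges Y \<subseteq> edges X"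

text \<open>
  Colours are elements of a well-ordered type \<open>'c\<close>, which stands for an initial segment of the
  class of ordinals. The cardinals over which \<open>list_number\<close> minimises live on the
  same type. Once \<open>'c\<close> is infinite and has at least \<open>|verts X|\<close> elements, this is the list
  chromatic number for colours in the class of all ordinals: \<open>|verts X|\<close> itself is
  an admissible list size (\<open>choosable_card_verts\<close>), and for a smaller list size the lists of a
  given assignment contain at most \<open>|UNIV :: 'c set|\<close> colours altogether.
\<close>

definition good_coloring :: "'v graph \<Rightarrow> ('v \<Rightarrow> 'c::wellorder) \<Rightarrow> bool" where
  "good_coloring X f \<longleftrightarrow> (\<forall>x y. {x, y} \<in> edges X \<longrightarrow> f x \<noteq> f y)"

definition list_assignment :: "'v graph \<Rightarrow> 'l rel \<Rightarrow> ('v \<Rightarrow> 'c::wellorder set) \<Rightarrow> bool" where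
  "list_assignment X \<theta> F \<longleftrightarrow> (\<forall>x\<in>verts X. |F x| =o \<theta>)"

definition choosable :: "'v graph \<Rightarrow> 'c::wellorder rel \<Rightarrow> bool" where
  "choosable X \<theta> \<longleftrightarrow>
     (\<forall>F :: 'v \<Rightarrow> 'c set. list_assignment X \<theta> F \<longrightarrow>
        (\<exists>f. good_coloring X f \<and> (\<forall>x\<in>verts X. f x \<in> F x)))"

definition is_list_number :: "'v graph \<Rightarrow> 'c::wellorder rel \<Rightarrow> bool" where
  "is_list_number X \<theta> \<longleftrightarrow> Card_order \<theta> \<and> choosable X \<theta> \<and>
     (\<forall>\<nu> :: 'c rel. Card_order \<nu> \<and> choosable X \<nu> \<longrightarrow> \<theta> \<le>o \<nu>)"

definition list_number :: "'v graph \<Rightarrow> 'c::wellorder rel" where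
  "list_number X = (SOME \<theta>. is_list_number X \<theta>)"

lemma choosable_card_verts:
  fixes X :: "'v graph" and \<nu> :: "'c::wellorder rel"
  assumes X: "is_graph X" and \<nu>: "|verts X| =o \<nu>"
  shows "choosable X \<nu>"
  unfolding choosable_def
proof (intro allI impI)
  fix F :: "'v \<Rightarrow> 'c set"
  assume F: "list_assignment X \<nu> F"
  let ?r = "|verts X|"
  have fld: "Field ?r = verts X" by (rule Field_card_of)
  have wo: "Well_order ?r" by (rule card_of_Well_order)
  have wf: "wf (?r - Id)"
    using wo unfolding well_order_on_def by blast
  define f where "f = wfrec (?r - Id) (\<lambda>g x. SOME c. c \<in> F x - g ` underS ?r x)"
  have f_eq: "f x = (SOME c. c \<in> F x - f ` underS ?r x)" for x
  proof -
    have "f x = (SOME c. c \<in> F x - cut f (?r - Id) x ` underS ?r x)"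
      unfolding f_def by (subst wfrec[OF wf]) simp
    moreover have "cut f (?r - Id) x ` underS ?r x = f ` underS ?r x"
      by (rule image_cong[OF refl]) (simp add: cut_def underS_def)
    ultimately show ?thesis by simp
  qed
  have f_in: "f x \<in> F x - f ` underS ?r x" if x: "x \<in> verts X" for x
  proof -
    have "|f ` underS ?r x| \<le>o |underS ?r x|" by (rule card_of_image)
    also have "|underS ?r x| <o ?r"
      by (rule card_of_underS[OF card_of_Card_order]) (simp add: fld x)
    also have "?r =o \<nu>" by (rule \<nu>)
    also have "\<nu> =o |F x|"
      using F x by (auto simp: list_assignment_def intro: ordIso_symmetric)
    finally have "|f ` underS ?r x| <o |F x|" .
    then have "\<not> F x \<subseteq> f ` underS ?r x"
      using card_of_mono1 not_ordLess_ordLeq by blast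
    then have "\<exists>c. c \<in> F x - f ` underS ?r x" by blast
    then show ?thesis by (subst f_eq) (rule someI_ex)
  qed
  have "f x \<noteq> f y" if e: "{x, y} \<in> edges X" for x y
  proof -
    have xy: "x \<in> verts X" "y \<in> verts X" "x \<noteq> y"
      using X e by (auto simp: is_graph_def)
    have "x \<in> underS ?r y \<or> y \<in> underS ?r x"
    proof -
      have "total_on (Field ?r) ?r"
        using wo unfolding well_order_on_def linear_order_on_def by blast
      then have "(x, y) \<in> ?r \<or> (y, x) \<in> ?r"
        using xy unfolding total_on_def fld by blast
      then show ?thesis using xy(3) by (auto simp: underS_def)
    qed
    then show ?thesis using f_in[OF xy(1)] f_in[OF xy(2)] by (metis DiffD2 imageI)
  qed
  then show "\<exists>f. good_coloring X f \<and> (\<forall>x\<in>verts X. f x \<in> F x)"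
    using f_in unfolding good_coloring_def by blast
qed

lemma is_list_number_list_number:
  fixes X :: "'v graph"
  assumes X: "is_graph X" and le: "|verts X| \<le>o |UNIV :: 'c::wellorder set|"
  shows "is_list_number X (list_number X :: 'c rel)"
proof -
  obtain g :: "'v \<Rightarrow> 'c" where g: "inj_on g (verts X)"
    using iffD2[OF card_of_ordLeq le] by (elim exE conjE)
  have "|verts X| =o |g ` verts X|"
    using g by (meson card_of_ordIsoI inj_on_imp_bij_betw)
  then have "choosable X |g ` verts X|"
    by (rule choosable_card_verts[OF X])
  then have "{\<nu> :: 'c rel. Card_order \<nu> \<and> choosable X \<nu>} \<noteq> {}"
    using card_of_Card_order by blast
  from exists_minim_Card_order[OF this] obtain \<theta> :: "'c rel" where "is_list_number X \<theta>"
    by (auto simp: is_list_number_def)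
  then show ?thesis
    unfolding list_number_def by (rule someI)
qed

end

theory Submission
  imports Defs
begin

text \<open>
  Call a vertex heavy over a set \<open>A\<close> if it has at least \<open>\<theta>\<close> neighbours in \<open>A\<close>. If \<open>|A| = \<mu>\<close> and
  \<open>2\<^sup>\<mu> = \<mu>\<^sup>+\<close>, at most \<open>\<mu>\<close> vertices are heavy over \<open>A\<close>, since otherwise a subgraph of size \<open>\<mu>\<^sup>+\<close>
  has a list assignment that diagonalises against all colourings of \<open>A\<close>. Hence \<open>A\<close> is contained
  in a set of the same size over which no outside vertex is heavy. Along a cofinal set of such
  \<open>\<mu>\<close>, Shelah's interleaving of enumerations produces a continuous increasing chain of such closed
  sets with union \<open>X\<close>. The colouring is then built along the chain: each new vertex has fewer
  than \<open>\<theta>\<close> coloured neighbours, so deleting their colours leaves \<open>\<theta>\<close> many in its list, and each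
  step of the chain lives on a subgraph of size \<open>< \<kappa>\<close>.
\<close>

section \<open>Partial list colourings, heavy vertices and basic cardinal facts\<close>

definition nbrs :: "'v graph \<Rightarrow> 'v \<Rightarrow> 'v set" where
  "nbrs X x = {y. {x, y} \<in> edges X}"

definition induced :: "'v graph \<Rightarrow> 'v set \<Rightarrow> 'v graph" where
  "induced X W = Graph W {e \<in> edges X. e \<subseteq> W}"

text \<open>Relative to a vertex set rather than a subgraph, so that partial colourings are compared
  inside one fixed \<open>X\<close>. List sizes are left free, since lists lose colours during the
  construction.\<close>

definition list_colouring :: "'v graph \<Rightarrow> ('v \<Rightarrow> 'c set) \<Rightarrow> 'v set \<Rightarrow> ('v \<Rightarrow> 'c) \<Rightarrow> bool" where
  "list_colouring X F W f \<longleftrightarrow>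
     (\<forall>x\<in>W. f x \<in> F x) \<and> (\<forall>x\<in>W. \<forall>y\<in>W. {x, y} \<in> edges X \<longrightarrow> f x \<noteq> f y)"

definition heavy :: "'v graph \<Rightarrow> 'l rel \<Rightarrow> 'v set \<Rightarrow> 'v set" where
  "heavy X \<theta> A = {x \<in> verts X. \<theta> \<le>o |nbrs X x \<inter> A|}"

lemma heavy_mono: "A \<subseteq> B \<Longrightarrow> heavy X \<theta> A \<subseteq> heavy X \<theta> B"
  unfolding heavy_def
  by (auto elim!: ordLeq_transitive intro!: card_of_mono1)

lemma subgraph_induced: "is_graph X \<Longrightarrow> W \<subseteq> verts X \<Longrightarrow> subgraph (induced X W) X"
  by (auto simp: subgraph_def induced_def is_graph_def)

lemma Card_order_ordLeq_obtain_subset: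
  assumes "Card_order r" and "r \<le>o |A|"
  obtains B where "B \<subseteq> A" "|B| =o r"
proof -
  have "|Field r| \<le>o |A|"
    using card_of_Field_ordIso[OF assms(1)] assms(2) ordIso_ordLeq_trans by blast
  then obtain B where "B \<subseteq> A" "|Field r| =o |B|"
    using internalize_card_of_ordLeq2 by metis
  then show thesis
    using that card_of_Field_ordIso[OF assms(1)] ordIso_symmetric ordIso_transitive by blast
qed

lemma card_of_Pow_mono:
  assumes "|A| \<le>o |B|"
  shows "|Pow A| \<le>o |Pow B|"
proof -
  obtain f where f: "inj_on f A" "f ` A \<subseteq> B"
    using assms card_of_ordLeq[of A B] by auto
  have "inj_on ((`) f) (Pow A)" "(`) f ` Pow A \<subseteq> Pow B"
    using inj_on_image_Pow[OF f(1)] f(2) by auto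
  then show ?thesis
    using card_of_ordLeq by blast
qed

lemma card_of_Un_ordLeq:
  "\<not> finite C \<Longrightarrow> |A| \<le>o |C| \<Longrightarrow> |B| \<le>o |C| \<Longrightarrow> |A \<union> B| \<le>o |C|"
  by (rule card_of_Un_ordLeq_infinite_Field) (simp_all add: Field_card_of card_of_card_order_on)

section \<open>From list numbers to colourings, and the bound on heavy vertices\<close>

text \<open>\<open>choosable\<close> speaks of lists of one exact size, so each list is first shrunk
  to a subset of cardinality \<open>list_number X\<close>. The bound \<open>le\<close> on the colour
  type is what makes \<open>list_number\<close> meet its specification.\<close>

lemma list_colouring_if_list_number_ordLeq:
  fixes X :: "'v graph" and F :: "'v \<Rightarrow> 'c::wellorder set" and \<theta> :: "'l rel"
  assumes X: "is_graph X" and le: "|verts X| \<le>o |UNIV :: 'c set|"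
    and num: "(list_number X :: 'c rel) \<le>o \<theta>"
    and F: "\<forall>x\<in>verts X. \<theta> \<le>o |F x|"
  shows "\<exists>f. list_colouring X F (verts X) f"
proof -
  define \<nu> where "\<nu> = (list_number X :: 'c rel)"
  have \<nu>: "Card_order \<nu>" "choosable X \<nu>"
    using is_list_number_list_number[OF X le] unfolding is_list_number_def \<nu>_def by auto
  have "\<exists>B \<subseteq> F x. |B| =o \<nu>" if "x \<in> verts X" for x
    using Card_order_ordLeq_obtain_subset[OF \<nu>(1)] ordLeq_transitive[OF num] F that
    unfolding \<nu>_def by metis
  then obtain G where G: "\<And>x. x \<in> verts X \<Longrightarrow> G x \<subseteq> F x \<and> |G x| =o \<nu>"
    by metis
  then have "list_assignment X \<nu> G"
    unfolding list_assignment_def by blast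
  with \<nu>(2) obtain f where "good_coloring X f" "\<forall>x\<in>verts X. f x \<in> G x"
    unfolding choosable_def by blast
  with G show ?thesis
    unfolding list_colouring_def good_coloring_def by blast
qed

text \<open>
  If \<open>A\<close> carries pairwise disjoint lists, a colouring of \<open>A\<close> is determined by its range, so
  the hypothesis on \<open>Pow U\<close> bounds their number by \<open>|U|\<^sup>+\<close>; \<open>|U|\<^sup>+\<close> heavy vertices suffice to diagonalise
  against all of them, each taking as its list the colours that one range uses on its neighbours.
\<close>

lemma card_of_heavy:
  fixes X :: "'v graph" and \<theta> :: "'l rel" and U :: "'u set"
  assumes \<theta>: "Cinfinite \<theta>" "\<theta> \<le>o |U|"
    and A: "A \<subseteq> verts X" "|A| \<le>o |U|"
    and pow: "|Pow U| \<le>o cardSuc |U|"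
    and col: "|U| \<le>o |UNIV :: 'c set|"
    and choose: "\<And>W (F :: 'v \<Rightarrow> 'c set). W \<subseteq> verts X \<Longrightarrow> |W| \<le>o cardSuc |U| \<Longrightarrow>
      \<forall>x\<in>W. \<theta> \<le>o |F x| \<Longrightarrow> \<exists>f. list_colouring X F W f"
  shows "|heavy X \<theta> A| \<le>o |U|"
proof (rule ccontr)
  assume "\<not> |heavy X \<theta> A| \<le>o |U|"
  have inf: "\<not> finite U"
    using \<theta> by (metis Field_card_of cinfinite_def cinfinite_mono)
  \<comment> \<open>Only heavy vertices outside \<open>A\<close> can receive lists independently of
    those on \<open>A\<close>. Removing \<open>A\<close>, which has at most \<open>|U|\<close>
    elements, still leaves more than \<open>|U|\<close> of them.\<close>
  let ?H = "heavy X \<theta> A - A"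
  have "\<not> |?H| \<le>o |U|"
  proof
    assume "|?H| \<le>o |U|"
    then have "|?H \<union> A| \<le>o |U|"
      by (rule card_of_Un_ordLeq[OF inf _ A(2)])
    moreover have "|heavy X \<theta> A| \<le>o |?H \<union> A|"
      by (rule card_of_mono1) blast
    ultimately show False
      using \<open>\<not> |heavy X \<theta> A| \<le>o |U|\<close> by (blast dest: ordLeq_transitive)
  qed
  then have "|U| <o |?H|"
    by (simp only: not_ordLeq_iff_ordLess card_of_Well_order)
  then have "cardSuc |U| \<le>o |?H|"
    by (rule cardSuc_least[OF card_of_Card_order card_of_Card_order])
  then obtain B where B: "B \<subseteq> ?H" "|B| =o cardSuc |U|"
    by (rule Card_order_ordLeq_obtain_subset[OF cardSuc_Card_order[OF card_of_Card_order]])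
  have "|A \<times> Field \<theta>| \<le>o |U|"
  proof (rule card_of_Times_ordLeq_infinite_Field)
    show "|Field \<theta>| \<le>o |U|"
      using card_of_Field_ordIso \<theta> ordIso_ordLeq_trans by blast
  qed (simp_all add: inf A(2) Field_card_of card_of_card_order_on)
  moreover from this have "|A \<times> Field \<theta>| \<le>o |UNIV :: 'c set|"
    using col ordLeq_transitive by blast
  \<comment> \<open>The injection \<open>h\<close> supplies the pairwise disjoint lists on
    \<open>A\<close>: the vertex \<open>a\<close> gets the colours \<open>h (a, l)\<close>, so a
    colour reveals its vertex.\<close>
  then obtain h :: "'v \<times> 'l \<Rightarrow> 'c" where h: "inj_on h (A \<times> Field \<theta>)"
    using card_of_ordLeq[of "A \<times> Field \<theta>" "UNIV :: 'c set"] by auto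
  define R where "R = h ` (A \<times> Field \<theta>)"
  ultimately have "|R| \<le>o |U|"
    unfolding R_def using ordLeq_transitive[OF card_of_image] by blast
  then have "|Pow R| \<le>o |B|"
    by (rule ordLeq_ordIso_trans[OF ordLeq_transitive[OF card_of_Pow_mono pow] ordIso_symmetric[OF B(2)]])
  \<comment> \<open>Each subset of the palette \<open>R\<close>, hence each possible range of a
    colouring of \<open>A\<close>, is guessed by some \<open>b\<close> in \<open>B\<close>.\<close>
  then obtain t where t: "t ` B = Pow R"
    using card_of_ordLeq2[of "Pow R" B] by auto
  define L where "L b = h ` ((nbrs X b \<inter> A) \<times> Field \<theta>)" for b
  \<comment> \<open>Here \<open>L x\<close> holds the colours that neighbours of \<open>x\<close> in
    \<open>A\<close> may use. The default \<open>UNIV\<close> only keeps the list large when the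
    guess \<open>t x\<close> leaves too few of them.\<close>
  define F where "F x = (if x \<in> A then h ` ({x} \<times> Field \<theta>)
      else if \<theta> \<le>o |t x \<inter> L x| then t x \<inter> L x else UNIV)" for x
  have "\<theta> \<le>o |F x|" for x
  proof (cases "x \<in> A")
    case True
    have "inj_on (\<lambda>l. h (x, l)) (Field \<theta>)"
      using h True by (auto simp: inj_on_def)
    then have "|Field \<theta>| \<le>o |h ` ({x} \<times> Field \<theta>)|"
      by (intro card_of_ordLeqI[where f="\<lambda>l. h (x, l)"]) auto
    with \<theta>(1) have "\<theta> \<le>o |h ` ({x} \<times> Field \<theta>)|"
      by (blast intro: ordIso_ordLeq_trans[OF ordIso_symmetric[OF card_of_Field_ordIso]])
    then show ?thesis
      using True unfolding F_def by simp
  next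
    case False
    then show ?thesis
      using ordLeq_transitive[OF \<theta>(2) col] unfolding F_def by auto
  qed
  moreover have "|A \<union> B| \<le>o cardSuc |U|"
  proof (rule card_of_Un_ordLeq_infinite_Field)
    show "\<not> finite (Field (cardSuc |U| ))"
      using inf cardSuc_finite[OF card_of_Card_order, of U] by (simp add: Field_card_of)
    show "|A| \<le>o cardSuc |U|"
      using A(2) cardSuc_ordLeq[OF card_of_Card_order] ordLeq_transitive by blast
    show "|B| \<le>o cardSuc |U|"
      using B(2) ordIso_imp_ordLeq by blast
  qed (rule cardSuc_Card_order[OF card_of_Card_order])
  moreover have "A \<union> B \<subseteq> verts X"
    using A(1) B(1) unfolding heavy_def by auto
  ultimately obtain f where "list_colouring X F (A \<union> B) f"
    using choose[of "A \<union> B" F] by blast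
  then have f: "\<And>x. x \<in> A \<union> B \<Longrightarrow> f x \<in> F x"
    and good: "\<And>x y. x \<in> A \<union> B \<Longrightarrow> y \<in> A \<union> B \<Longrightarrow> {x, y} \<in> edges X \<Longrightarrow> f x \<noteq> f y"
    unfolding list_colouring_def by auto
  have fA: "\<exists>l\<in>Field \<theta>. f a = h (a, l)" if "a \<in> A" for a
    using f[of a] that unfolding F_def by auto
  then have "f ` A \<in> Pow R"
    unfolding R_def by fastforce
  then obtain b where b: "b \<in> B" "t b = f ` A"
    using t by (metis imageE)
  have "b \<notin> A" and hb: "\<theta> \<le>o |nbrs X b \<inter> A|"
    using b(1) B(1) unfolding heavy_def by auto
  have "inj_on f A"
  proof (rule inj_onI)
    fix x y assume "x \<in> A" "y \<in> A" "f x = f y"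
    then show "x = y"
      using fA[of x] fA[of y] h by (auto simp: inj_on_def)
  qed
  \<comment> \<open>The guess at \<open>b\<close> is correct and \<open>b\<close> is heavy, so the
    injective \<open>f\<close> already puts \<open>\<theta>\<close> colours into
    \<open>t b \<inter> L b\<close>; the default is not taken at \<open>b\<close>.\<close>
  moreover have "f ` (nbrs X b \<inter> A) \<subseteq> t b \<inter> L b"
    using fA b(2) unfolding L_def by fastforce
  ultimately have "|nbrs X b \<inter> A| \<le>o |t b \<inter> L b|"
    by (intro card_of_ordLeqI[where f=f]) (auto intro: inj_on_subset)
  then have "F b = t b \<inter> L b"
    using \<open>b \<notin> A\<close> ordLeq_transitive[OF hb] unfolding F_def by auto
  \<comment> \<open>The colour of \<open>b\<close> is the colour of some \<open>a\<close> in
    \<open>A\<close> and is also reserved for a neighbour \<open>a'\<close> of \<open>b\<close>.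
    Disjointness of the lists gives \<open>a = a'\<close>, an edge with equally coloured
    ends.\<close>
  then have "f b \<in> f ` A" "f b \<in> L b"
    using f[of b] b by auto
  then obtain a a' l' where a: "a \<in> A" "f b = f a" "a' \<in> nbrs X b \<inter> A" "l' \<in> Field \<theta>" "f b = h (a', l')"
    unfolding L_def by auto
  then have "a = a'"
    using fA[of a] h by (auto simp: inj_on_def)
  then show False
    using good[of b a] a b(1) unfolding nbrs_def by auto
qed

section \<open>Colouring along a filtration\<close>

lemma in_underS_iff: "a \<in> underS r b \<longleftrightarrow> (a, b) \<in> r - Id"
  by (auto simp: underS_def)

lemma underS_trans_left:
  assumes r: "trans r" "antisym r" and ab: "(a, b) \<in> r" and bc: "b \<in> underS r c"
  shows "a \<in> underS r c"
proof -
  have "(a, c) \<in> r"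
    using transD[OF r(1) ab] bc unfolding underS_def by blast
  moreover have "a \<noteq> c"
    using antisymD[OF r(2)] ab bc unfolding underS_def by blast
  ultimately show ?thesis
    unfolding underS_def by blast
qed

lemma ordLeq_card_of_Diff:
  assumes \<theta>: "Cinfinite \<theta>" and S: "\<theta> \<le>o |S|" and T: "|T| <o \<theta>"
  shows "\<theta> \<le>o |S - T|"
proof (rule ccontr)
  assume "\<not> \<theta> \<le>o |S - T|"
  then have "|S - T| <o \<theta>"
    using \<theta> by (simp add: not_ordLeq_iff_ordLess card_of_Well_order card_order_on_well_order_on)
  then have "|(S - T) \<union> T| <o \<theta>"
    using \<theta> T by (intro card_of_Un_ordLess_infinite_Field) (auto simp: cinfinite_def)
  moreover have "|S| \<le>o |(S - T) \<union> T|"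
    by (rule card_of_mono1) blast
  ultimately have "|S| <o \<theta>"
    by (blast intro: ordLeq_ordLess_trans)
  then show False
    using S not_ordLess_ordLeq by blast
qed

text \<open>The new vertices \<open>A k - B k\<close> are coloured by recursion on \<open>k\<close>.
  None of them is heavy over the earlier part \<open>B k\<close>, so deleting the colours of earlier
  neighbours removes fewer than \<open>\<theta>\<close> colours from each list.\<close>

lemma list_colouring_filtration:
  fixes r :: "'k rel" and A :: "'k \<Rightarrow> 'v set" and F :: "'v \<Rightarrow> 'c set" and \<theta> :: "'l rel"
  assumes wo: "Well_order r" and K: "K \<subseteq> Field r" and \<theta>: "Cinfinite \<theta>"
    and V: "verts X = (\<Union>k\<in>K. A k)"
    and closed: "\<And>k. k \<in> K \<Longrightarrow>
      heavy X \<theta> (\<Union>j\<in>K \<inter> underS r k. A j) \<subseteq> (\<Union>j\<in>K \<inter> underS r k. A j)"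
    and choose: "\<And>k (F :: 'v \<Rightarrow> 'c set). k \<in> K \<Longrightarrow> \<forall>x\<in>A k. \<theta> \<le>o |F x| \<Longrightarrow>
      \<exists>f. list_colouring X F (A k) f"
    and F: "\<forall>x\<in>verts X. \<theta> \<le>o |F x|"
  shows "\<exists>f. list_colouring X F (verts X) f"
proof -
  define B where "B k = (\<Union>j\<in>K \<inter> underS r k. A j)" for k
  have wf: "wf (r - Id)"
    using wo unfolding well_order_on_def by blast
  \<comment> \<open>Taking the least index whose set contains \<open>x\<close> assigns each vertex
    to exactly one layer \<open>A k - B k\<close>.\<close>
  have "\<exists>k\<in>K. x \<in> A k - B k" if x: "x \<in> verts X" for x
  proof -
    let ?K = "{k \<in> K. x \<in> A k}"
    obtain k0 where "k0 \<in> ?K"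
      using x V by blast
    then obtain k where k: "k \<in> ?K" and min: "\<forall>j. (j, k) \<in> r - Id \<longrightarrow> j \<notin> ?K"
      using wf unfolding wf_eq_minimal by meson
    have "x \<notin> B k"
      using min by (auto simp: B_def in_underS_iff)
    with k show ?thesis
      by blast
  qed
  then obtain rk where rk: "\<And>x. x \<in> verts X \<Longrightarrow> rk x \<in> K \<and> x \<in> A (rk x) - B (rk x)"
    by metis
  have tot: "(a, b) \<in> r" if "a \<in> K" "b \<in> K" "(b, a) \<notin> r - Id" for a b
  proof -
    have "total_on (Field r) r" "refl_on (Field r) r"
      using wo unfolding order_on_defs by auto
    then show ?thesis
      using that K unfolding total_on_def refl_on_def by (cases "a = b") auto
  qed
  have rkB: "rk y \<in> K \<inter> underS r k" if y: "y \<in> B k" and k: "k \<in> K" for y k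
  proof -
    obtain j where j: "j \<in> K" "j \<in> underS r k" "y \<in> A j"
      using y unfolding B_def by blast
    then have "y \<in> verts X"
      using V by blast
    have "j \<notin> underS r (rk y)"
      using rk[OF \<open>y \<in> verts X\<close>] j unfolding B_def by blast
    then have "(rk y, j) \<in> r"
      using tot[of "rk y" j] j rk[OF \<open>y \<in> verts X\<close>] unfolding in_underS_iff by blast
    moreover have "trans r" "antisym r"
      using wo unfolding order_on_defs by auto
    ultimately have "rk y \<in> underS r k"
      using j(2) underS_trans_left by fast
    then show ?thesis
      using rk[OF \<open>y \<in> verts X\<close>] by blast
  qed
  \<comment> \<open>Each earlier vertex \<open>y\<close> is read off from the colouring of its own
    layer \<open>rk y\<close>. By \<open>rkB\<close> that layer lies strictly below
    \<open>k\<close>, which makes the recursion well-founded.\<close>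
  define F' where "F' g k x = F x - (\<lambda>y. g (rk y) y) ` (nbrs X x \<inter> B k)" for g :: "'k \<Rightarrow> 'v \<Rightarrow> 'c" and k x
  have "\<exists>g. \<forall>k. k \<in> K \<longrightarrow> list_colouring X (F' g k) (A k - B k) (g k)"
  proof (rule dependent_wf_choice[OF wf, where P="\<lambda>g k f. k \<in> K \<longrightarrow> list_colouring X (F' g k) (A k - B k) f"])
    fix f g :: "'k \<Rightarrow> 'v \<Rightarrow> 'c" and k h
    assume eq: "\<And>z. (z, k) \<in> r - Id \<Longrightarrow> f z = g z"
    have "F' f k = F' g k" if "k \<in> K"
    proof
      fix x
      have "(\<lambda>y. f (rk y) y) ` (nbrs X x \<inter> B k) = (\<lambda>y. g (rk y) y) ` (nbrs X x \<inter> B k)"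
        using rkB[OF _ that] eq by (intro image_cong) (auto simp: in_underS_iff)
      then show "F' f k x = F' g k x"
        unfolding F'_def by simp
    qed
    then show "(k \<in> K \<longrightarrow> list_colouring X (F' f k) (A k - B k) h) =
        (k \<in> K \<longrightarrow> list_colouring X (F' g k) (A k - B k) h)"
      by auto
  next
    fix k and g :: "'k \<Rightarrow> 'v \<Rightarrow> 'c"
    show "\<exists>f. k \<in> K \<longrightarrow> list_colouring X (F' g k) (A k - B k) f"
    proof (cases "k \<in> K")
      case k: True
      have "\<theta> \<le>o |F' g k x|" if "x \<in> A k - B k" for x
        unfolding F'_def
      proof (rule ordLeq_card_of_Diff[OF \<theta>])
        have x: "x \<in> verts X"
          using V k that by blast
        then show "\<theta> \<le>o |F x|"
          using F by blast
        have "\<not> \<theta> \<le>o |nbrs X x \<inter> B k|"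
          using closed[OF k] that x unfolding heavy_def B_def by blast
        then have "|nbrs X x \<inter> B k| <o \<theta>"
          using \<theta> by (simp add: not_ordLeq_iff_ordLess card_of_Well_order card_order_on_well_order_on)
        then show "|(\<lambda>y. g (rk y) y) ` (nbrs X x \<inter> B k)| <o \<theta>"
          by (rule ordLeq_ordLess_trans[OF card_of_image])
      qed
      \<comment> \<open>\<open>choose\<close> colours all of \<open>A k\<close>, so old vertices
        keep their original lists here; the colours it gives them are discarded.\<close>
      then have "\<forall>x\<in>A k. \<theta> \<le>o |if x \<in> B k then F x else F' g k x|"
        using F V k by auto
      from choose[OF k this] obtain f where
        f: "list_colouring X (\<lambda>x. if x \<in> B k then F x else F' g k x) (A k) f" ..
      then have "list_colouring X (F' g k) (A k - B k) f"
        unfolding list_colouring_def by auto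
      then show ?thesis
        by blast
    qed simp
  qed
  then obtain g where g: "\<And>k. k \<in> K \<Longrightarrow> list_colouring X (F' g k) (A k - B k) (g k)"
    by blast
  define f where "f x = g (rk x) x" for x
  have fF': "f x \<in> F' g (rk x) x" if "x \<in> verts X" for x
    using g rk[OF that] unfolding list_colouring_def f_def by blast
  have less: "f x \<noteq> f y" if "x \<in> verts X" "y \<in> verts X" "{x, y} \<in> edges X" "(rk y, rk x) \<in> r - Id" for x y
  proof -
    have "y \<in> nbrs X x \<inter> B (rk x)"
      using that(3,4) rk[OF that(2)] by (auto simp: nbrs_def B_def in_underS_iff)
    then show ?thesis
      using fF'[OF that(1)] unfolding F'_def f_def[of y] by auto
  qed
  have "f x \<noteq> f y" if xy: "x \<in> verts X" "y \<in> verts X" "{x, y} \<in> edges X" for x y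
  proof -
    consider "(rk y, rk x) \<in> r - Id" | "(rk x, rk y) \<in> r - Id" | "rk x = rk y"
      using tot[of "rk x" "rk y"] rk xy by blast
    then show ?thesis
    proof cases
      case 2
      then show ?thesis
        using less[of y x] xy by (metis insert_commute)
    next
      case 3
      then show ?thesis
        using g[of "rk x"] rk[OF xy(1)] rk[OF xy(2)] xy unfolding list_colouring_def f_def by auto
    qed (use less xy in blast)
  qed
  moreover have "f x \<in> F x" if "x \<in> verts X" for x
    using fF'[OF that] unfolding F'_def by blast
  ultimately show ?thesis
    unfolding list_colouring_def by blast
qed

section \<open>Continuous filtrations by closed sets\<close>

lemma ordLeq_obtain_cover:
  assumes "|A| \<le>o |B|"
  obtains g where "A \<subseteq> g ` B"
proof (cases "A = {}")
  case False
  then show ?thesis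
    using that card_of_ordLeq2[of A B] assms by auto
qed (use that in blast)

text \<open>Heaviness is witnessed by just \<open>\<theta>\<close> neighbours, and the successor of
  \<open>\<theta>\<close> is regular, so all of these witnesses lie in one member of the
  chain.\<close>

lemma heavy_UNION_chain:
  assumes \<theta>: "Cinfinite \<theta>" and chain: "relChain (cardSuc \<theta>) As"
  shows "heavy X \<theta> (\<Union>z\<in>Field (cardSuc \<theta>). As z) \<subseteq> (\<Union>z\<in>Field (cardSuc \<theta>). heavy X \<theta> (As z))"
proof
  fix x assume x: "x \<in> heavy X \<theta> (\<Union>z\<in>Field (cardSuc \<theta>). As z)"
  obtain B where B: "B \<subseteq> nbrs X x \<inter> (\<Union>z\<in>Field (cardSuc \<theta>). As z)" "|B| =o \<theta>"
    using \<theta> x Card_order_ordLeq_obtain_subset[of \<theta>] unfolding heavy_def by blast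
  then have "B \<subseteq> (\<Union>z\<in>Field (cardSuc \<theta>). As z)"
    by blast
  then obtain z where z: "z \<in> Field (cardSuc \<theta>)" "B \<subseteq> As z"
    using cardSuc_UNION_Cinfinite[OF \<theta> chain _ ordIso_imp_ordLeq[OF B(2)]] by blast
  have "|B| \<le>o |nbrs X x \<inter> As z|"
    using B(1) z(2) by (intro card_of_mono1) blast
  then have "\<theta> \<le>o |nbrs X x \<inter> As z|"
    by (rule ordIso_ordLeq_trans[OF ordIso_symmetric[OF B(2)]])
  then show "x \<in> (\<Union>z\<in>Field (cardSuc \<theta>). heavy X \<theta> (As z))"
    using x z unfolding heavy_def by blast
qed

text \<open>
  The sets \<open>A i\<close> are built in \<open>\<theta>\<^sup>+\<close> stages, simultaneously for all \<open>i\<close>. At each stage every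
  set built so far is enumerated, and the part of the enumeration below \<open>i\<close> is
  added to the set with index \<open>i\<close>. When \<open>i\<close> is a limit of \<open>J\<close>, each element of \<open>A i\<close> has its
  place in such an enumeration below some smaller \<open>j\<close>, which yields continuity. Closure under
  \<open>D\<close> is not disturbed, as an element of \<open>D\<close> of the union is already caught at an earlier stage.
\<close>

lemma continuous_filtration:
  fixes r :: "'k rel" and \<theta> :: "'l rel" and D :: "'v set \<Rightarrow> 'v set"
  assumes wo: "Well_order r" and \<theta>: "Cinfinite \<theta>" and V: "|V| \<le>o |Field r|"
    and J1: "\<And>i. i \<in> J \<Longrightarrow> cardSuc \<theta> \<le>o |underS r i|"
    and J2: "\<And>i. i \<in> J \<Longrightarrow> |J| \<le>o |underS r i|"
    and Dmono: "\<And>A B. A \<subseteq> B \<Longrightarrow> D A \<subseteq> D B"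
    and DV: "\<And>A. D A \<subseteq> V"
    and Dcard: "\<And>i A. i \<in> J \<Longrightarrow> A \<subseteq> V \<Longrightarrow> |A| \<le>o |underS r i| \<Longrightarrow> |D A| \<le>o |underS r i|"
    and Dchain: "\<And>As. relChain (cardSuc \<theta>) As \<Longrightarrow>
      D (\<Union>z\<in>Field (cardSuc \<theta>). As z) \<subseteq> (\<Union>z\<in>Field (cardSuc \<theta>). D (As z))"
  shows "\<exists>A. (\<forall>i\<in>J. A i \<subseteq> V \<and> |A i| \<le>o |underS r i| \<and> D (A i) \<subseteq> A i) \<and>
    (\<forall>i j. (i, j) \<in> r \<longrightarrow> A i \<subseteq> A j) \<and>
    (\<forall>v\<in>V. \<exists>\<xi>\<in>Field r. \<forall>i. \<xi> \<in> underS r i \<longrightarrow> v \<in> A i) \<and>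
    (\<forall>i\<in>J. (\<forall>\<xi>\<in>underS r i. \<exists>j\<in>J \<inter> underS r i. \<xi> \<in> underS r j) \<longrightarrow>
      A i \<subseteq> (\<Union>j\<in>J \<inter> underS r i. A j))"
proof -
  let ?\<rho> = "cardSuc \<theta>"
  have \<rho>: "Card_order ?\<rho>" "Well_order ?\<rho>" "\<not> finite (Field ?\<rho>)"
    using \<theta> Cinfinite_cardSuc[OF \<theta>] cardSuc_Card_order cardSuc_Well_order by (auto simp: cinfinite_def)
  have wf: "wf (?\<rho> - Id)"
    using \<rho>(2) unfolding well_order_on_def by blast
  have tr: "trans r" "antisym r"
    using wo unfolding order_on_defs by auto
  obtain e where e: "V \<subseteq> e ` Field r"
    using ordLeq_obtain_cover[OF V] .
  have "\<exists>g. |S| \<le>o |U| \<longrightarrow> S \<subseteq> g ` U" for S :: "'v set" and U :: "'k set"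
    using ordLeq_obtain_cover by metis
  then obtain en :: "'v set \<Rightarrow> 'k set \<Rightarrow> 'k \<Rightarrow> 'v" where en: "\<And>S U. |S| \<le>o |U| \<Longrightarrow> S \<subseteq> en S U ` U"
    by metis
  \<comment> \<open>One stage, at all indices at once. The \<open>e\<close> part makes the sets
    exhaust \<open>V\<close>; the last part interleaves the enumerations for all \<open>l\<close> in
    \<open>J\<close>. Intersecting with \<open>S l\<close> drops stray values of \<open>en\<close>,
    which is only known to cover.\<close>
  define \<Phi> where "\<Phi> S i = S i \<union> D (S i) \<union> (V \<inter> e ` underS r i) \<union>
      (\<Union>l\<in>J. S l \<inter> en (S l) (underS r l) ` underS r i)" for S i
  have "\<exists>T. \<forall>z. T z = \<Phi> (\<lambda>i. \<Union>y\<in>underS ?\<rho> z. T y i)"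
  proof (rule dependent_wf_choice[OF wf, where P="\<lambda>T z S. S = \<Phi> (\<lambda>i. \<Union>y\<in>underS ?\<rho> z. T y i)"])
    fix f g :: "'l set \<Rightarrow> 'k \<Rightarrow> 'v set" and z S
    assume "\<And>y. (y, z) \<in> ?\<rho> - Id \<Longrightarrow> f y = g y"
    then have "(\<lambda>i. \<Union>y\<in>underS ?\<rho> z. f y i) = (\<lambda>i. \<Union>y\<in>underS ?\<rho> z. g y i)"
      unfolding in_underS_iff[symmetric] by simp
    then show "(S = \<Phi> (\<lambda>i. \<Union>y\<in>underS ?\<rho> z. f y i)) = (S = \<Phi> (\<lambda>i. \<Union>y\<in>underS ?\<rho> z. g y i))"
      by simp
  qed blast
  then obtain T where T: "\<And>z. T z = \<Phi> (\<lambda>i. \<Union>y\<in>underS ?\<rho> z. T y i)"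
    by blast
  define P where "P z i = (\<Union>y\<in>underS ?\<rho> z. T y i)" for z i
  have TP: "T z = \<Phi> (P z)" for z
    using T unfolding P_def .
  have inf: "\<not> finite (underS r i)" if "i \<in> J" for i
    using cinfinite_mono[OF J1[OF that]] Cinfinite_cardSuc[OF \<theta>] by (simp add: cinfinite_def Field_card_of)
  \<comment> \<open>\<open>J1\<close> bounds the number of earlier stages, and \<open>J2\<close> the
    number of enumerations feeding index \<open>i\<close>.\<close>
  have small: "\<forall>i\<in>J. T z i \<subseteq> V \<and> |T z i| \<le>o |underS r i|" for z
  proof (induction z rule: wf_induct_rule[OF wf])
    case (1 z)
    then have IH: "\<And>y i. y \<in> underS ?\<rho> z \<Longrightarrow> i \<in> J \<Longrightarrow> T y i \<subseteq> V \<and> |T y i| \<le>o |underS r i|"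
      unfolding in_underS_iff by blast
    have PV: "P z i \<subseteq> V" if "i \<in> J" for i
      using IH[OF _ that] unfolding P_def by blast
    have Psmall: "|P z i| \<le>o |underS r i|" if i: "i \<in> J" for i
      unfolding P_def
    proof (rule card_of_UNION_ordLeq_infinite[OF inf[OF i]])
      have "|underS ?\<rho> z| \<le>o |Field ?\<rho>|"
        by (rule card_of_mono1[OF Order_Relation.underS_Field])
      also have "|Field ?\<rho>| =o ?\<rho>"
        by (rule card_of_Field_ordIso[OF \<rho>(1)])
      also have "?\<rho> \<le>o |underS r i|"
        by (rule J1[OF i])
      finally show "|underS ?\<rho> z| \<le>o |underS r i|" .
    qed (use IH i in blast)
    show ?case
    proof (intro ballI conjI)
      fix i assume i: "i \<in> J"
      show "T z i \<subseteq> V"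
        unfolding TP \<Phi>_def using PV DV i by blast
      have img: "|X \<inter> f ` underS r i| \<le>o |underS r i|" for X and f :: "'k \<Rightarrow> 'v"
        by (rule ordLeq_transitive[OF card_of_mono1 card_of_image]) blast
      show "|T z i| \<le>o |underS r i|"
        unfolding TP \<Phi>_def
        by (intro card_of_Un_ordLeq[OF inf[OF i]] card_of_UNION_ordLeq_infinite[OF inf[OF i]]
            Psmall[OF i] Dcard[OF i] PV[OF i] J2[OF i] img ballI)
    qed
  qed
  have T_mono: "T y i \<subseteq> T z i" if "(y, z) \<in> ?\<rho>" for y z i
  proof (cases "y = z")
    case False
    then have "T y i \<subseteq> P z i"
      using that unfolding P_def underS_def by blast
    also have "\<dots> \<subseteq> T z i"
      unfolding TP \<Phi>_def by blast
    finally show ?thesis .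
  qed simp
  have T_mono2: "T z i \<subseteq> T z j" if ij: "(i, j) \<in> r" for z i j
  proof (induction z rule: wf_induct_rule[OF wf])
    case (1 z)
    then have "P z i \<subseteq> P z j"
      unfolding P_def in_underS_iff[symmetric] by blast
    moreover note Dmono[OF this] underS_incr[OF tr ij]
    ultimately show ?case
      unfolding TP \<Phi>_def by blast
  qed
  \<comment> \<open>The length of the construction is a limit, so whatever appears at one stage is
    processed by \<open>\<Phi>\<close> at a later one.\<close>
  have next_stage: "\<exists>z'\<in>Field ?\<rho>. z \<in> underS ?\<rho> z'" if "z \<in> Field ?\<rho>" for z
    using infinite_Card_order_limit[OF \<rho>(1,3) that] unfolding underS_def by blast
  define A where "A i = (\<Union>z\<in>Field ?\<rho>. T z i)" for i
  show ?thesis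
  proof (intro exI[of _ A] conjI ballI allI impI)
    fix i assume i: "i \<in> J"
    show "A i \<subseteq> V"
      using small i unfolding A_def by blast
    show "|A i| \<le>o |underS r i|"
      unfolding A_def
    proof (rule card_of_UNION_ordLeq_infinite[OF inf[OF i]])
      show "|Field ?\<rho>| \<le>o |underS r i|"
        by (rule ordIso_ordLeq_trans[OF card_of_Field_ordIso[OF \<rho>(1)] J1[OF i]])
    qed (use small i in blast)
    show "D (A i) \<subseteq> A i"
    proof
      fix x assume "x \<in> D (A i)"
      moreover have "relChain ?\<rho> (\<lambda>z. T z i)"
        unfolding relChain_def using T_mono by blast
      ultimately obtain z where z: "z \<in> Field ?\<rho>" "x \<in> D (T z i)"
        using Dchain unfolding A_def by blast
      then obtain z' where z': "z' \<in> Field ?\<rho>" "z \<in> underS ?\<rho> z'"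
        using next_stage by blast
      then have "D (T z i) \<subseteq> D (P z' i)"
        unfolding P_def by (intro Dmono) blast
      then have "x \<in> T z' i"
        using z(2) unfolding TP[of z'] \<Phi>_def by blast
      then show "x \<in> A i"
        using z'(1) unfolding A_def by blast
    qed
    assume lim: "\<forall>\<xi>\<in>underS r i. \<exists>j\<in>J \<inter> underS r i. \<xi> \<in> underS r j"
    show "A i \<subseteq> (\<Union>j\<in>J \<inter> underS r i. A j)"
    proof
      fix x assume "x \<in> A i"
      then obtain z where z: "z \<in> Field ?\<rho>" "x \<in> T z i"
        unfolding A_def by blast
      then obtain z' where z': "z' \<in> Field ?\<rho>" "z \<in> underS ?\<rho> z'"
        using next_stage by blast
      have x: "x \<in> P z' i"
        using z z' unfolding P_def by blast
      have "P z' i \<subseteq> T z' i"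
        unfolding TP[of z'] \<Phi>_def by blast
      then have "|P z' i| \<le>o |underS r i|"
        using small[of z'] i card_of_mono1 ordLeq_transitive by blast
      then obtain \<xi> where \<xi>: "\<xi> \<in> underS r i" "x = en (P z' i) (underS r i) \<xi>"
        using en x by blast
      then obtain j where j: "j \<in> J \<inter> underS r i" "\<xi> \<in> underS r j"
        using lim by blast
      \<comment> \<open>This is the last part of \<open>\<Phi>\<close> at index \<open>j\<close>
        with \<open>l = i\<close>: the larger set \<open>P z' i\<close> passes down the element it
        lists at \<open>\<xi>\<close>, a place below \<open>j\<close>.\<close>
      then have "x \<in> T z' j"
        using x \<xi>(2) i unfolding TP[of z'] \<Phi>_def by blast
      then show "x \<in> (\<Union>j\<in>J \<inter> underS r i. A j)"
        using j z' unfolding A_def by blast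
    qed
  next
    show "A i \<subseteq> A j" if "(i, j) \<in> r" for i j
      using T_mono2[OF that] unfolding A_def by blast
    obtain z where z: "z \<in> Field ?\<rho>"
      using \<rho>(3) by (metis ex_in_conv finite.emptyI)
    fix v assume v: "v \<in> V"
    then obtain \<xi> where \<xi>: "\<xi> \<in> Field r" "v = e \<xi>"
      using e by blast
    have "v \<in> T z i" if "\<xi> \<in> underS r i" for i
      using that \<xi>(2) v unfolding TP[of z] \<Phi>_def by blast
    then show "\<exists>\<xi>\<in>Field r. \<forall>i. \<xi> \<in> underS r i \<longrightarrow> v \<in> A i"
      using z \<xi>(1) unfolding A_def by blast
  qed
qed

section \<open>Singular cardinals and the main argument\<close>

text \<open>Infinite successor cardinals are regular, so a singular cardinal is never one. This
  keeps the subgraphs of size \<open>\<mu>\<^sup>+\<close> used for diagonalisation below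
  \<open>\<kappa>\<close>.\<close>

lemma cardSuc_ordLess_singular:
  assumes \<kappa>: "singular_cardinal \<kappa>" and r: "Cinfinite r" and less: "r <o \<kappa>"
  shows "cardSuc r <o \<kappa>"
proof -
  have "cardSuc r \<le>o \<kappa>"
    using \<kappa> r less unfolding singular_cardinal_def by (blast intro: cardSuc_least)
  moreover have "\<not> cardSuc r =o \<kappa>"
    using regularCard_ordIso[OF _ Cinfinite_cardSuc[OF r] regularCard_cardSuc[OF r]] \<kappa>
    unfolding singular_cardinal_def by blast
  ultimately show ?thesis
    using ordLeq_iff_ordLess_or_ordIso by blast
qed

lemma ordLess_obtain_underS:
  assumes \<kappa>: "Card_order \<kappa>" and S: "|S| <o \<kappa>"
  obtains m where "m \<in> Field \<kappa>" "|S| =o |underS \<kappa> m|"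
proof -
  have wo: "Well_order \<kappa>"
    using \<kappa> card_order_on_well_order_on by blast
  obtain m where m: "m \<in> Field \<kappa>" "|S| =o Restr \<kappa> (underS \<kappa> m)"
    using S ordLess_iff_ordIso_Restr[OF wo card_of_Well_order] by blast
  have "Field (Restr \<kappa> (underS \<kappa> m)) = underS \<kappa> m"
    using wo Refl_Field_Restr2[of \<kappa> "underS \<kappa> m"] Order_Relation.underS_Field[of \<kappa> m]
    by (simp add: order_on_defs)
  then show thesis
    using that[OF m(1)] card_of_cong[OF m(2)] by (simp add: Field_card_of)
qed

lemma GCH_cardinals_below_Pow:
  assumes \<kappa>: "Well_order \<kappa>" and i: "i \<in> GCH_cardinals_below \<kappa>"
  shows "|Pow (underS \<kappa> i)| \<le>o cardSuc |underS \<kappa> i|"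
proof -
  let ?U = "underS \<kappa> i" and ?o = "ordinal_below \<kappa> i"
  have ob: "Card_order ?o" "ctwo ^c ?o =o cardSuc ?o"
    using i unfolding GCH_cardinals_below_def by auto
  have Fld: "Field ?o = ?U"
    using \<kappa> Refl_Field_Restr2[of \<kappa> "?U"] Order_Relation.underS_Field[of \<kappa> i]
    unfolding ordinal_below_def by (simp add: order_on_defs)
  have "?o =o |?U|"
    using card_of_Field_ordIso[OF ob(1)] ordIso_symmetric unfolding Fld by blast
  then have suc: "cardSuc ?o =o cardSuc |?U|"
    using cardSuc_invar_ordIso[OF ob(1) card_of_Card_order] by blast
  have "|Pow ?U| =o |Func ?U (UNIV :: bool set)|"
    by (rule card_of_Pow_Func)
  also have "|Func ?U (UNIV :: bool set)| = ctwo ^c ?o"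
    unfolding cexp_def ctwo_def Fld Field_card_of ..
  finally show ?thesis
    by (rule ordIso_imp_ordLeq[OF ordIso_transitive[OF ordIso_transitive[OF _ ob(2)] suc]])
qed

theorem theorem1p3:
  fixes \<kappa> :: "'k rel" and \<theta> :: "'l rel" and X :: "'v graph"
  assumes "singular_cardinal \<kappa>"
    and "\<exists>C. club_in C \<kappa> \<and> C \<subseteq> GCH_cardinals_below \<kappa>"
    and "is_graph X" and "|verts X| =o \<kappa>"
    and "Cinfinite \<theta>" and "\<theta> <o \<kappa>"
    and colours: "\<kappa> \<le>o |UNIV :: 'c::wellorder set|"
    and "\<And>Y. subgraph Y X \<Longrightarrow> |verts Y| <o \<kappa> \<Longrightarrow> (list_number Y :: 'c rel) \<le>o \<theta>"
  shows "(list_number X :: 'c rel) \<le>o \<theta>"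
proof -
  have \<kappa>: "Cinfinite \<kappa>" "Card_order \<kappa>" "Well_order \<kappa>"
    using assms(1) card_order_on_well_order_on unfolding singular_cardinal_def by auto
  then have lin: "trans \<kappa>" "antisym \<kappa>" "Total \<kappa>" "Refl \<kappa>"
    unfolding order_on_defs by auto
  have underS_trans: "a \<in> underS \<kappa> c" if "a \<in> underS \<kappa> b" "(b, c) \<in> \<kappa>" for a b c
    using underS_incr[OF lin(1,2) that(2)] that(1) by blast
  have underS_total: "a \<in> underS \<kappa> b" if "a \<in> Field \<kappa>" "b \<in> Field \<kappa>" "(b, a) \<notin> \<kappa>" for a b
    using lin(3,4) that unfolding total_on_def refl_on_def underS_def by (cases "a = b") auto
  have inf_F: "\<not> finite (Field \<kappa>)"
    using \<kappa>(1) by (simp add: cinfinite_def)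
  obtain C where C: "C \<subseteq> Field \<kappa>" "cofinal C \<kappa>" "closed_in C \<kappa>" "C \<subseteq> GCH_cardinals_below \<kappa>"
    using assms(2) unfolding club_in_def by blast
  have colourable: "\<exists>f. list_colouring X F W f"
    if W: "W \<subseteq> verts X" "|W| <o \<kappa>" and F: "\<forall>x\<in>W. \<theta> \<le>o |F x|" for W and F :: "'v \<Rightarrow> 'c set"
  proof -
    let ?Y = "induced X W"
    have vY: "verts ?Y = W"
      unfolding induced_def by simp
    have Y: "subgraph ?Y X"
      by (rule subgraph_induced[OF assms(3) W(1)])
    then have "is_graph ?Y"
      unfolding subgraph_def by blast
    moreover have "|verts ?Y| \<le>o |UNIV :: 'c set|"
      unfolding vY by (rule ordLeq_transitive[OF ordLess_imp_ordLeq[OF W(2)] colours])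
    moreover have "(list_number ?Y :: 'c rel) \<le>o \<theta>"
      using assms(8)[OF Y] W(2) unfolding vY by blast
    ultimately obtain f where "list_colouring ?Y F W f"
      using list_colouring_if_list_number_ordLeq[of ?Y \<theta> F] F unfolding vY by blast
    then show ?thesis
      unfolding list_colouring_def induced_def by auto
  qed
  obtain K0 where K0: "K0 \<subseteq> Field \<kappa>" "cofinal K0 \<kappa>" "|K0| <o \<kappa>"
  proof -
    obtain K where K: "K \<subseteq> Field \<kappa>" "cofinal K \<kappa>" "\<not> |K| =o \<kappa>"
      using assms(1) unfolding singular_cardinal_def regularCard_def by blast
    have "|K| \<le>o \<kappa>"
      by (rule ordLeq_ordIso_trans[OF card_of_mono1[OF K(1)] card_of_Field_ordIso[OF \<kappa>(2)]])
    with K that show thesis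
      using ordLeq_iff_ordLess_or_ordIso by blast
  qed
  have suc\<theta>: "|Field (cardSuc \<theta>)| =o cardSuc \<theta>"
    by (rule card_of_Field_ordIso[OF cardSuc_Card_order]) (use assms(5) in blast)
  \<comment> \<open>The summands are chosen to give \<open>J1\<close> and \<open>J2\<close> of the
    filtration lemma above \<open>m\<close>: one is the number of stages, and
    \<open>K0 <+> K0\<close> will map onto a superset of the index set \<open>J\<close>.\<close>
  let ?S = "Field (cardSuc \<theta>) <+> (K0 <+> K0)"
  have "|?S| <o \<kappa>"
    using ordIso_ordLess_trans[OF suc\<theta> cardSuc_ordLess_singular[OF assms(1,5,6)]] K0(3)
    by (intro card_of_Plus_ordLess_infinite_Field[OF inf_F \<kappa>(2)])
  then obtain m where m: "m \<in> Field \<kappa>" "|?S| =o |underS \<kappa> m|"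
    using ordLess_obtain_underS[OF \<kappa>(2)] by blast
  \<comment> \<open>The short cofinal set \<open>K0\<close> is pushed into \<open>C\<close> and
    above \<open>m\<close>.\<close>
  have "\<exists>c\<in>C. m \<in> underS \<kappa> c \<and> k \<in> underS \<kappa> c" if "k \<in> K0" for k
  proof -
    have k: "k \<in> Field \<kappa>"
      using that K0(1) by blast
    obtain M where M: "M \<in> Field \<kappa>" "(m, M) \<in> \<kappa>" "(k, M) \<in> \<kappa>"
      using underS_total[OF k m(1)] k m(1) lin(4) unfolding refl_on_def underS_def by blast
    obtain c where c: "c \<in> C" "M \<noteq> c" "(M, c) \<in> \<kappa>"
      using C(2) M(1) unfolding cofinal_def by blast
    then have "M \<in> underS \<kappa> c"
      unfolding underS_def by blast
    then show ?thesis
      using c(1) underS_trans_left[OF lin(1,2)] M(2,3) by blast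
  qed
  then obtain c where c: "\<And>k. k \<in> K0 \<Longrightarrow> c k \<in> C \<and> m \<in> underS \<kappa> (c k) \<and> k \<in> underS \<kappa> (c k)"
    by metis
  define K where "K = c ` K0"
  have K: "K \<subseteq> C" "\<And>k. k \<in> K \<Longrightarrow> k \<in> Field \<kappa> \<and> m \<in> underS \<kappa> k"
    using c C(1) unfolding K_def by auto
  have K_cofinal: "\<exists>k\<in>K. \<xi> \<in> underS \<kappa> k" if \<xi>: "\<xi> \<in> Field \<kappa>" for \<xi>
  proof -
    obtain k where "k \<in> K0" "(\<xi>, k) \<in> \<kappa>"
      using K0(2) \<xi> unfolding cofinal_def by blast
    then have "\<xi> \<in> underS \<kappa> (c k)"
      using underS_trans_left[OF lin(1,2)] c[of k] by simp
    then show ?thesis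
      using \<open>k \<in> K0\<close> unfolding K_def by blast
  qed
  text \<open>
    \<open>s k\<close> is the supremum of the elements of \<open>K\<close> below \<open>k\<close>. Adding these suprema to the index set
    suffices for the chain over \<open>K\<close> to be closed at limits, and keeps the index set small.
  \<close>
  define s where "s k = wo_rel.minim \<kappa> {d \<in> Field \<kappa>. \<forall>j\<in>K \<inter> underS \<kappa> k. (j, d) \<in> \<kappa>}" for k
  have s: "s k \<in> Field \<kappa>" "\<And>j. j \<in> K \<inter> underS \<kappa> k \<Longrightarrow> (j, s k) \<in> \<kappa>"
    "\<And>\<alpha>. \<alpha> \<in> underS \<kappa> (s k) \<Longrightarrow> \<exists>j\<in>K \<inter> underS \<kappa> k. \<alpha> \<in> underS \<kappa> j" if k: "k \<in> K" for k
  proof -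
    let ?D = "{d \<in> Field \<kappa>. \<forall>j\<in>K \<inter> underS \<kappa> k. (j, d) \<in> \<kappa>}"
    have wr: "wo_rel \<kappa>"
      using \<kappa>(3) unfolding wo_rel_def .
    have "k \<in> ?D"
      using K(2)[OF k] unfolding underS_def by blast
    then have "s k \<in> ?D"
      unfolding s_def by (intro wo_rel.minim_in[OF wr]) auto
    then show "s k \<in> Field \<kappa>" "\<And>j. j \<in> K \<inter> underS \<kappa> k \<Longrightarrow> (j, s k) \<in> \<kappa>"
      by auto
    fix \<alpha> assume \<alpha>: "\<alpha> \<in> underS \<kappa> (s k)"
    then have "\<alpha> \<in> Field \<kappa>"
      using Order_Relation.underS_Field by fast
    moreover have "\<alpha> \<notin> ?D"
    proof
      assume "\<alpha> \<in> ?D"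
      then have "(s k, \<alpha>) \<in> \<kappa>"
        unfolding s_def by (intro wo_rel.minim_least[OF wr]) auto
      then show False
        using \<alpha> lin(2) unfolding underS_def by (blast dest: antisymD)
    qed
    ultimately obtain j where "j \<in> K \<inter> underS \<kappa> k" "(j, \<alpha>) \<notin> \<kappa>"
      by blast
    then show "\<exists>j\<in>K \<inter> underS \<kappa> k. \<alpha> \<in> underS \<kappa> j"
      using underS_total[of \<alpha> j] \<open>\<alpha> \<in> Field \<kappa>\<close> K(2) by blast
  qed
  \<comment> \<open>If no element of \<open>K\<close> lies below \<open>k\<close>, then
    \<open>s k\<close> is the least element of \<open>\<kappa>\<close> and the condition on
    \<open>m\<close> discards it. Otherwise \<open>s k\<close> turns out to lie in
    \<open>C\<close>.\<close>
  define J where "J = {i \<in> C \<inter> (K \<union> s ` K). m \<in> underS \<kappa> i}"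
  have KJ: "K \<subseteq> J"
    using K unfolding J_def by blast
  have J: "i \<in> Field \<kappa>" "i \<in> GCH_cardinals_below \<kappa>" "|?S| \<le>o |underS \<kappa> i|" if i: "i \<in> J" for i
  proof -
    show "i \<in> Field \<kappa>" "i \<in> GCH_cardinals_below \<kappa>"
      using i C unfolding J_def by auto
    have "(m, i) \<in> \<kappa>"
      using i unfolding J_def underS_def by blast
    then show "|?S| \<le>o |underS \<kappa> i|"
      by (intro ordIso_ordLeq_trans[OF m(2)] card_of_mono1 underS_incr[OF lin(1,2)])
  qed
  have J_suc: "cardSuc \<theta> \<le>o |underS \<kappa> i|" if "i \<in> J" for i
    by (rule ordIso_ordLeq_trans[OF ordIso_symmetric[OF suc\<theta>]
        ordLeq_transitive[OF card_of_Plus1 J(3)[OF that]]])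
  have J_small: "|J| \<le>o |underS \<kappa> i|" if "i \<in> J" for i
  proof -
    have "|J| \<le>o |(\<lambda>x. case x of Inl k \<Rightarrow> c k | Inr k \<Rightarrow> s (c k)) ` (K0 <+> K0)|"
      unfolding J_def K_def by (rule card_of_mono1) (force simp: image_iff)
    then have "|J| \<le>o |K0 <+> K0|"
      by (rule ordLeq_transitive[OF _ card_of_image])
    then show ?thesis
      by (rule ordLeq_transitive[OF _ ordLeq_transitive[OF card_of_Plus2 J(3)[OF that]]])
  qed
  have J_less: "|underS \<kappa> i| <o \<kappa>" if "i \<in> J" for i
    by (rule card_of_underS[OF \<kappa>(2) J(1)[OF that]])
  have \<theta>J: "\<theta> \<le>o |underS \<kappa> i|" if "i \<in> J" for i
    using ordLeq_transitive[OF cardSuc_ordLeq J_suc[OF that]] assms(5) by blast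
  have heavy_small: "|heavy X \<theta> A| \<le>o |underS \<kappa> i|"
    if i: "i \<in> J" and A: "A \<subseteq> verts X" "|A| \<le>o |underS \<kappa> i|" for i A
  proof (rule card_of_heavy[OF assms(5) \<theta>J[OF i] A])
    show "|Pow (underS \<kappa> i)| \<le>o cardSuc |underS \<kappa> i|"
      by (rule GCH_cardinals_below_Pow[OF \<kappa>(3) J(2)[OF i]])
    show "|underS \<kappa> i| \<le>o |UNIV :: 'c set|"
      by (rule ordLeq_transitive[OF ordLess_imp_ordLeq[OF J_less[OF i]] colours])
    have "Cinfinite |underS \<kappa> i|"
      using cinfinite_mono[OF \<theta>J[OF i]] assms(5) card_of_Card_order by blast
    then have "cardSuc |underS \<kappa> i| <o \<kappa>"
      by (rule cardSuc_ordLess_singular[OF assms(1) _ J_less[OF i]])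
    then show "\<exists>f. list_colouring X F W f"
      if "W \<subseteq> verts X" "|W| \<le>o cardSuc |underS \<kappa> i|" "\<forall>x\<in>W. \<theta> \<le>o |F x|" for W and F :: "'v \<Rightarrow> 'c set"
      using colourable[OF that(1) _ that(3)] ordLeq_ordLess_trans[OF that(2)] by blast
  qed
  have "|verts X| \<le>o |Field \<kappa>|"
    using ordIso_transitive[OF assms(4) ordIso_symmetric[OF card_of_Field_ordIso[OF \<kappa>(2)]]]
    by (rule ordIso_imp_ordLeq)
  moreover have "heavy X \<theta> A \<subseteq> verts X" for A
    unfolding heavy_def by blast
  ultimately have "\<exists>A. (\<forall>i\<in>J. A i \<subseteq> verts X \<and> |A i| \<le>o |underS \<kappa> i| \<and> heavy X \<theta> (A i) \<subseteq> A i) \<and>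
    (\<forall>i j. (i, j) \<in> \<kappa> \<longrightarrow> A i \<subseteq> A j) \<and>
    (\<forall>v\<in>verts X. \<exists>\<xi>\<in>Field \<kappa>. \<forall>i. \<xi> \<in> underS \<kappa> i \<longrightarrow> v \<in> A i) \<and>
    (\<forall>i\<in>J. (\<forall>\<xi>\<in>underS \<kappa> i. \<exists>j\<in>J \<inter> underS \<kappa> i. \<xi> \<in> underS \<kappa> j) \<longrightarrow>
      A i \<subseteq> (\<Union>j\<in>J \<inter> underS \<kappa> i. A j))"
    by (intro continuous_filtration[OF \<kappa>(3) assms(5)] J_suc J_small heavy_small heavy_mono
        heavy_UNION_chain[OF assms(5)])
  then obtain A where A_all: "\<forall>i\<in>J. A i \<subseteq> verts X \<and> |A i| \<le>o |underS \<kappa> i| \<and> heavy X \<theta> (A i) \<subseteq> A i"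
    and A_mono: "\<forall>i j. (i, j) \<in> \<kappa> \<longrightarrow> A i \<subseteq> A j"
    and cover: "\<forall>v\<in>verts X. \<exists>\<xi>\<in>Field \<kappa>. \<forall>i. \<xi> \<in> underS \<kappa> i \<longrightarrow> v \<in> A i"
    and cont: "\<forall>i\<in>J. (\<forall>\<xi>\<in>underS \<kappa> i. \<exists>j\<in>J \<inter> underS \<kappa> i. \<xi> \<in> underS \<kappa> j) \<longrightarrow>
      A i \<subseteq> (\<Union>j\<in>J \<inter> underS \<kappa> i. A j)"
    by (elim exE conjE)
  then have A: "\<And>i. i \<in> J \<Longrightarrow> A i \<subseteq> verts X" "\<And>i. i \<in> J \<Longrightarrow> |A i| \<le>o |underS \<kappa> i|"
    and closed: "\<And>i. i \<in> J \<Longrightarrow> heavy X \<theta> (A i) \<subseteq> A i"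
    and mono: "\<And>i j. (i, j) \<in> \<kappa> \<Longrightarrow> A i \<subseteq> A j"
    by simp_all
  have V: "verts X = (\<Union>k\<in>K. A k)"
  proof
    show "verts X \<subseteq> (\<Union>k\<in>K. A k)"
      using cover K_cofinal by fast
  qed (use A(1) KJ in blast)
  \<comment> \<open>The union over \<open>K\<close> below \<open>k\<close> equals
    \<open>A (s k)\<close> unless it is empty. Either \<open>s k\<close> is the largest element of
    \<open>K\<close> below \<open>k\<close>, or it is a limit of such elements; then closedness of
    \<open>C\<close> puts it in \<open>J\<close>, and continuity of \<open>A\<close>
    applies.\<close>
  have B_closed: "heavy X \<theta> (\<Union>j\<in>K \<inter> underS \<kappa> k. A j) \<subseteq> (\<Union>j\<in>K \<inter> underS \<kappa> k. A j)" if k: "k \<in> K" for k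
  proof (cases "K \<inter> underS \<kappa> k = {}")
    case True
    have "\<not> \<theta> \<le>o |{} :: 'v set|"
      using cinfinite_mono[of \<theta> "|{} :: 'v set|"] assms(5) by (auto simp: cinfinite_def Field_card_of)
    then show ?thesis
      unfolding True heavy_def by simp
  next
    case False
    let ?d = "s k"
    have lim: "\<exists>j\<in>K \<inter> underS \<kappa> k \<inter> underS \<kappa> ?d. \<alpha> \<in> underS \<kappa> j"
      if nK: "?d \<notin> K \<inter> underS \<kappa> k" and \<alpha>: "\<alpha> \<in> underS \<kappa> ?d" for \<alpha>
    proof -
      obtain j where j: "j \<in> K \<inter> underS \<kappa> k" "\<alpha> \<in> underS \<kappa> j"
        using s(3)[OF k \<alpha>] by blast
      then have "j \<in> underS \<kappa> ?d"
        using s(2)[OF k j(1)] nK j(1) unfolding underS_def[of _ ?d] by blast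
      with j show ?thesis
        by blast
    qed
    obtain j0 where "j0 \<in> K \<inter> underS \<kappa> k"
      using False by blast
    then have md: "m \<in> underS \<kappa> ?d"
      using K(2) s(2)[OF k] underS_trans by blast
    have "?d \<in> C"
    proof (cases "?d \<in> K \<inter> underS \<kappa> k")
      case nK: False
      have "\<exists>\<beta>\<in>C \<inter> underS \<kappa> ?d. \<alpha> \<noteq> \<beta> \<and> (\<alpha>, \<beta>) \<in> \<kappa>" if "\<alpha> \<in> underS \<kappa> ?d" for \<alpha>
        using lim[OF nK that] K(1) unfolding underS_def by blast
      then show ?thesis
        using C(3) s(1)[OF k] md unfolding closed_in_def by blast
    qed (use K(1) in blast)
    then have dJ: "?d \<in> J"
      using k md unfolding J_def by blast
    have "A ?d = (\<Union>j\<in>K \<inter> underS \<kappa> k. A j)"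
    proof
      show "(\<Union>j\<in>K \<inter> underS \<kappa> k. A j) \<subseteq> A ?d"
        using mono s(2)[OF k] by blast
      show "A ?d \<subseteq> (\<Union>j\<in>K \<inter> underS \<kappa> k. A j)"
      proof (cases "?d \<in> K \<inter> underS \<kappa> k")
        case nK: False
        have "A ?d \<subseteq> (\<Union>j\<in>J \<inter> underS \<kappa> ?d. A j)"
          using bspec[OF cont dJ] lim[OF nK] KJ by blast
        also have "\<dots> \<subseteq> (\<Union>j\<in>K \<inter> underS \<kappa> k. A j)"
        proof (rule UN_least)
          fix j assume "j \<in> J \<inter> underS \<kappa> ?d"
          then obtain j' where "j' \<in> K \<inter> underS \<kappa> k" "(j, j') \<in> \<kappa>"
            using lim[OF nK, of j] unfolding underS_def by blast
          then show "A j \<subseteq> (\<Union>j\<in>K \<inter> underS \<kappa> k. A j)"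
            using mono by blast
        qed
        finally show ?thesis .
      qed blast
    qed
    then show ?thesis
      using closed[OF dJ] by simp
  qed
  have colouring: "\<exists>f. list_colouring X F (verts X) f" if F: "\<forall>x\<in>verts X. \<theta> \<le>o |F x|" for F :: "'v \<Rightarrow> 'c set"
  proof (rule list_colouring_filtration[OF \<kappa>(3) _ assms(5) V B_closed _ F])
    show "K \<subseteq> Field \<kappa>"
      using K(2) by blast
    show "\<exists>f. list_colouring X G (A k) f" if "k \<in> K" "\<forall>x\<in>A k. \<theta> \<le>o |G x|" for k and G :: "'v \<Rightarrow> 'c set"
      using colourable[OF A(1) _ that(2)] ordLeq_ordLess_trans[OF A(2) J_less] that(1) KJ by blast
  qed
  have Xle: "|verts X| \<le>o |UNIV :: 'c set|"
    by (rule ordIso_ordLeq_trans[OF assms(4) colours])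
  have "\<theta> \<le>o |UNIV :: 'c set|"
    by (rule ordLeq_transitive[OF ordLess_imp_ordLeq[OF assms(6)] colours])
  \<comment> \<open>Minimality of \<open>list_number\<close> compares only with cardinals on the
    colour type, so \<open>\<theta>\<close> is replaced by a copy there.\<close>
  then obtain L :: "'c set" where L: "|L| =o \<theta>"
    using Card_order_ordLeq_obtain_subset assms(5) by metis
  have "choosable X ( |L| )"
    unfolding choosable_def
  proof (intro allI impI)
    fix F :: "'v \<Rightarrow> 'c set"
    assume "list_assignment X ( |L| ) F"
    then have "\<forall>x\<in>verts X. \<theta> \<le>o |F x|"
      unfolding list_assignment_def
      using ordIso_transitive[OF ordIso_symmetric[OF L] ordIso_symmetric] ordIso_imp_ordLeq by blast
    then obtain f where f: "list_colouring X F (verts X) f"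
      using colouring by blast
    have "x \<in> verts X \<and> y \<in> verts X" if "{x, y} \<in> edges X" for x y
      using that assms(3) unfolding is_graph_def by blast
    with f show "\<exists>f. good_coloring X f \<and> (\<forall>x\<in>verts X. f x \<in> F x)"
      unfolding list_colouring_def good_coloring_def by blast
  qed
  then have "(list_number X :: 'c rel) \<le>o |L|"
    using is_list_number_list_number[OF assms(3) Xle] card_of_Card_order
    unfolding is_list_number_def by blast
  then show ?thesis
    by (rule ordLeq_ordIso_trans[OF _ L])
qed

end
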